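(* Let $M$ be a topological vector space and let $\{f_1,\dots,f_n\}$ be a set of machines on $M$, with dependency graph $(V,E)$, $V=\{1,\dots,n\}$. Assume that $(V,E)$ is acyclic, with a layering $\{V_1,\dots,V_k\}$. Let $f=f_1+\dots+f_n$. Then $f$ is a machine, and $$S_f=\Big(\mathrm{id}_M+\sum_{v\in V_k}(S_{f_v}-\mathrm{id}_M)\Big)\circ\dots\circ\Big(\mathrm{id}_M+\sum_{v\in V_1}(S_{f_v}-\mathrm{id}_M)\Big).$$
   Context: Maps into a topological vector space are added pointwise. A continuous (not necessarily linear) map $f\colon M\to M$ on a topological vector space $M$ is a machine if, for every topological space $X$ and every continuous map $g\colon X\to M$, there exists a unique continuous map $h\colon X\to M$ such that $h=g+f\circ h$; this $h$ is called the stable state of $f$ with initial condition $g$, and $S_f$ denotes the stable state of $f$ with initial condition $\mathrm{id}_M$. For continuous maps $f,f'\colon M\to M$, we say that $f$ does not depend on $f'$ if, for every topological space $X$, all continuous maps $b,b'\colon X\to M$, and every $\lambda\in\mathbb{R}$, one has $f\circ(b+\lambda\,(f'\circ b'))=f\circ b$; otherwise $f$ depends on $f'$. The dependency graph of $\{f_1,\dots,f_n\}$ is the directed graph with vertex set $\{1,\dots,n\}$ and with a directed edge from $i$ to $j$ (for $i\neq j$) if and only if $f_j$ depends on $f_i$. A layering of height $k$ of a finite directed graph $(V,E)$ is a partition $\{V_1,\dots,V_k\}$ of $V$ such that whenever there is an edge from a vertex of $V_i$ to a vertex of $V_j$, then $i<j$. *)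

theory Defs
  imports "HOL-Analysis.Analysis"
begin

text \<open>Real topological vector spaces. No separation axiom is assumed.\<close>

class real_topological_vector_space = topological_ab_group_add + real_vector +
  assumes tendsto_scaleR_nhds_Pair:
    "LIM x (nhds c \<times>\<^sub>F nhds a). fst x *\<^sub>R snd x :> nhds (c *\<^sub>R a)"

instance real_normed_vector < real_topological_vector_space
proof
  fix c :: real and a :: 'a
  show "LIM x (nhds c \<times>\<^sub>F nhds a). fst x *\<^sub>R snd x :> nhds (c *\<^sub>R a)"
    unfolding nhds_prod[symmetric]
    by (intro tendsto_scaleR tendsto_fst[where a = "(c, a)", simplified]
          tendsto_snd[where a = "(c, a)", simplified] filterlim_ident)
qed

text \<open>
  Topological spaces are abstract topologies, whose carrier \<^term>\<open>topspace X\<close> may be any subset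
  of a type; \<^const>\<open>euclidean\<close> is the topology that the type \<open>'m\<close> carries as a topological space.
  A map \<open>X \<rightarrow> M\<close> is represented by a function that is \<^const>\<open>undefined\<close> off \<^term>\<open>topspace X\<close>
  (\<^const>\<open>extensional\<close>), so that equality of maps, and hence unique existence, is the intended one.
\<close>

definition is_stable_state ::
  "'x topology \<Rightarrow> ('m::real_topological_vector_space \<Rightarrow> 'm) \<Rightarrow> ('x \<Rightarrow> 'm) \<Rightarrow> ('x \<Rightarrow> 'm) \<Rightarrow> bool" where
  "is_stable_state X f g h \<longleftrightarrow>
     h \<in> extensional (topspace X) \<and> continuous_map X euclidean h \<and>
     (\<forall>x\<in>topspace X. h x = g x + f (h x))"

text \<open>
  A definition cannot quantify over all types, so the type \<open>'x\<close> from which the points of the test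
  spaces \<open>X\<close> are taken is a parameter of \<open>machine\<close> and \<open>does_not_depend_on\<close>. The lemmas
  \<open>machine_any_type\<close> and \<open>does_not_depend_on_any_type\<close> below show that the choice \<open>'x = 'm\<close>
  already yields the property for all topological spaces on all types.
\<close>

definition machine :: "'x itself \<Rightarrow> ('m::real_topological_vector_space \<Rightarrow> 'm) \<Rightarrow> bool" where
  "machine (_ :: 'x itself) f \<longleftrightarrow>
     continuous_on UNIV f \<and>
     (\<forall>(X :: 'x topology) g. continuous_map X euclidean g \<longrightarrow> (\<exists>!h. is_stable_state X f g h))"

definition stable_state ::
  "'x topology \<Rightarrow> ('m::real_topological_vector_space \<Rightarrow> 'm) \<Rightarrow> ('x \<Rightarrow> 'm) \<Rightarrow> 'x \<Rightarrow> 'm" where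
  "stable_state X f g = (THE h. is_stable_state X f g h)"

definition S :: "('m::real_topological_vector_space \<Rightarrow> 'm) \<Rightarrow> 'm \<Rightarrow> 'm" where
  "S f = stable_state euclidean f id"

definition does_not_depend_on ::
  "'x itself \<Rightarrow> ('m::real_topological_vector_space \<Rightarrow> 'm) \<Rightarrow> ('m \<Rightarrow> 'm) \<Rightarrow> bool" where
  "does_not_depend_on (_ :: 'x itself) f f' \<longleftrightarrow>
     (\<forall>(X :: 'x topology) b b' (c::real).
        continuous_map X euclidean b \<longrightarrow> continuous_map X euclidean b' \<longrightarrow>
        (\<forall>x\<in>topspace X. f (b x + c *\<^sub>R f' (b' x)) = f (b x)))"

definition depends_on :: "('m::real_topological_vector_space \<Rightarrow> 'm) \<Rightarrow> ('m \<Rightarrow> 'm) \<Rightarrow> bool" where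
  "depends_on f f' \<longleftrightarrow> \<not> does_not_depend_on TYPE('m) f f'"

definition dependency_edges ::
  "nat \<Rightarrow> (nat \<Rightarrow> 'm::real_topological_vector_space \<Rightarrow> 'm) \<Rightarrow> (nat \<times> nat) set" where
  "dependency_edges n f =
     {(i, j). i \<in> {1..n} \<and> j \<in> {1..n} \<and> i \<noteq> j \<and> depends_on (f j) (f i)}"

definition layering :: "'v set \<Rightarrow> ('v \<times> 'v) set \<Rightarrow> nat \<Rightarrow> (nat \<Rightarrow> 'v set) \<Rightarrow> bool" where
  "layering V E k L \<longleftrightarrow>
     partition_on V (L ` {1..k}) \<and> inj_on L {1..k} \<and>
     (\<forall>i\<in>{1..k}. \<forall>j\<in>{1..k}. \<forall>v\<in>L i. \<forall>w\<in>L j. (v, w) \<in> E \<longrightarrow> i < j)"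

text \<open>\<open>compose_upto k F\<close> is \<open>F k \<circ> \<dots> \<circ> F 1\<close>.\<close>

primrec compose_upto :: "nat \<Rightarrow> (nat \<Rightarrow> 'a \<Rightarrow> 'a) \<Rightarrow> 'a \<Rightarrow> 'a" where
  "compose_upto 0 F = id"
| "compose_upto (Suc k) F = F (Suc k) \<circ> compose_upto k F"

lemma machine_any_type:
  fixes f :: "'m::real_topological_vector_space \<Rightarrow> 'm"
  assumes "machine TYPE('m) f"
  shows "machine TYPE('x) f"
proof -
  have ex: "\<exists>!h. is_stable_state (euclidean :: 'm topology) f g h"
    if "continuous_map euclidean euclidean g" for g
    using assms that unfolding machine_def by blast
  obtain s where s: "is_stable_state (euclidean :: 'm topology) f id s"
    using ex[of id] by auto
  have uniq: "m = m'" if "m = c + f m" "m' = c + f m'" for c m m'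
  proof -
    have "is_stable_state (euclidean :: 'm topology) f (\<lambda>_. c) (\<lambda>_. m)"
      "is_stable_state (euclidean :: 'm topology) f (\<lambda>_. c) (\<lambda>_. m')"
      using that by (simp_all add: is_stable_state_def)
    then have "(\<lambda>_::'m. m) = (\<lambda>_. m')"
      using ex[of "\<lambda>_. c"] by auto
    then show ?thesis by metis
  qed
  have "\<exists>!h. is_stable_state X f g h" if g: "continuous_map X euclidean g"
    for X :: "'x topology" and g
  proof (rule ex_ex1I)
    have "continuous_map X euclidean (s \<circ> g)"
      using g s continuous_map_compose unfolding is_stable_state_def by blast
    then have "continuous_map X euclidean (restrict (s \<circ> g) (topspace X))"
      by (rule continuous_map_eq) simp
    then have "is_stable_state X f g (restrict (s \<circ> g) (topspace X))"
      using s by (auto simp: is_stable_state_def)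
    then show "\<exists>h. is_stable_state X f g h" by blast
  next
    fix h h' assume "is_stable_state X f g h" "is_stable_state X f g h'"
    then show "h = h'"
      unfolding is_stable_state_def by (intro extensionalityI[of h "topspace X" h']) (auto intro: uniq)
  qed
  with assms show ?thesis
    unfolding machine_def by blast
qed

lemma does_not_depend_on_any_type:
  fixes f f' :: "'m::real_topological_vector_space \<Rightarrow> 'm"
  assumes "does_not_depend_on TYPE('x) f f'"
  shows "does_not_depend_on TYPE('y) f f'"
proof -
  have "f (a + c *\<^sub>R f' a') = f a" for a a' and c :: real
  proof -
    let ?X = "discrete_topology UNIV :: 'x topology"
    have "continuous_map ?X euclidean (\<lambda>_. a)" "continuous_map ?X euclidean (\<lambda>_. a')"
      by simp_all
    with assms show ?thesis
      unfolding does_not_depend_on_def by (metis UNIV_I topspace_discrete_topology)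
  qed
  then show ?thesis
    by (simp add: does_not_depend_on_def)
qed

end

(* A continuous f is a machine iff the equation m = c + f m has, for every c, exactly one solution
   s c and s is continuous; then s = S f.  If f does not depend on g and m = c + f m + g m, then
   p = m - g m satisfies p = c + f p, so p = S f c and m = S g p.  In a layer of mutually
   independent machines, m = c + (SUM v. f v m) gives f v m = f v (c + f v m), so that
   c + f v m = S (f v) c.  Since no layer depends on a later one, the layers compose in order. *)

theory Submission
  imports Defs
begin

text \<open>This form mentions no test space: the equivalence packs existence and uniqueness of the
  solution for each constant \<open>c\<close>, and continuity of \<open>s\<close> transfers
  solvability to any space by composition.\<close>

definition solution_map :: "('m::real_topological_vector_space \<Rightarrow> 'm) \<Rightarrow> ('m \<Rightarrow> 'm) \<Rightarrow> bool" where
  "solution_map f s \<longleftrightarrow> continuous_on UNIV s \<and> (\<forall>c m. m = c + f m \<longleftrightarrow> m = s c)"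

text \<open>The stable state equation can be solved at each point separately, which forces
  \<open>s (g x)\<close>; \<open>restrict\<close> supplies the value \<open>undefined\<close> off
  the carrier. Continuity of \<open>h\<close> stays a separate condition because \<open>g\<close> is
  arbitrary here.\<close>

lemma solution_map_is_stable_state_iff:
  assumes "solution_map f s"
  shows "is_stable_state X f g h \<longleftrightarrow>
    continuous_map X euclidean h \<and> h = restrict (s \<circ> g) (topspace X)"
proof -
  have "h = restrict (s \<circ> g) (topspace X) \<longleftrightarrow>
      h \<in> extensional (topspace X) \<and> (\<forall>x\<in>topspace X. h x = s (g x))"
    by (auto simp: fun_eq_iff extensional_def)
  moreover have "h x = g x + f (h x) \<longleftrightarrow> h x = s (g x)" for x
    using assms by (simp add: solution_map_def)
  ultimately show ?thesis
    by (auto simp: is_stable_state_def)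
qed

lemma solution_map_imp_machine:
  assumes "continuous_on UNIV f" and s: "solution_map f s"
  shows "machine TYPE('x) f"
proof -
  have "continuous_map X euclidean (restrict (s \<circ> g) (topspace X))"
    if "continuous_map X euclidean g" for X :: "'x topology" and g
  proof -
    have "continuous_map X euclidean (s \<circ> g)"
      using s that by (auto simp: solution_map_def intro: continuous_map_compose)
    then show ?thesis
      by (rule continuous_map_eq) simp
  qed
  with assms(1) show ?thesis
    unfolding machine_def solution_map_is_stable_state_iff[OF s] by blast
qed

lemma S_eq_solution_map:
  assumes "solution_map f s"
  shows "S f = s"
proof -
  have "is_stable_state euclidean f id h \<longleftrightarrow> h = s" for h
    using assms solution_map_is_stable_state_iff[OF assms, of euclidean id h]
    by (auto simp: solution_map_def)
  then show ?thesis
    by (simp add: S_def stable_state_def)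
qed

lemma machine_solution_map_S:
  fixes f :: "'m::real_topological_vector_space \<Rightarrow> 'm"
  assumes "machine TYPE('m) f"
  shows "solution_map f (S f)"
proof -
  have ex: "\<exists>!h. is_stable_state (euclidean :: 'm topology) f g h"
    if "continuous_on UNIV g" for g
    using assms that unfolding machine_def by simp
  obtain s where s: "is_stable_state (euclidean :: 'm topology) f id s"
    using ex[of id] by auto
  have "m = s c" if "m = c + f m" for c m
  proof -
    \<comment> \<open>Two solutions for the same \<open>c\<close> are two constant stable states
      with constant initial condition \<open>c\<close>, so uniqueness over the test space M
      identifies them.\<close>
    have "is_stable_state (euclidean :: 'm topology) f (\<lambda>_. c) (\<lambda>_. m)"
      "is_stable_state (euclidean :: 'm topology) f (\<lambda>_. c) (\<lambda>_. s c)"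
      using that s by (simp_all add: is_stable_state_def)
    then have "(\<lambda>_::'m. m) = (\<lambda>_. s c)"
      using ex[of "\<lambda>_. c"] by auto
    then show ?thesis by metis
  qed
  with s have "solution_map f s"
    by (auto simp: solution_map_def is_stable_state_def)
  with S_eq_solution_map show ?thesis by blast
qed

text \<open>Constant maps on M already test all pairs of points, and conversely the condition on
  maps is checked pointwise.\<close>

lemma not_depends_on_iff:
  fixes f g :: "'m::real_topological_vector_space \<Rightarrow> 'm"
  shows "\<not> depends_on f g \<longleftrightarrow> (\<forall>a b c. f (a + c *\<^sub>R g b) = f a)"
proof
  assume L: "\<not> depends_on f g"
  show "\<forall>a b c. f (a + c *\<^sub>R g b) = f a"
  proof (intro allI)
    fix a b :: 'm and c :: real
    have "continuous_map euclidean euclidean (\<lambda>_::'m. a)"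
      "continuous_map euclidean euclidean (\<lambda>_::'m. b)"
      by simp_all
    with L show "f (a + c *\<^sub>R g b) = f a"
      unfolding depends_on_def does_not_depend_on_def by (metis UNIV_I topspace_euclidean)
  qed
qed (simp add: depends_on_def does_not_depend_on_def)

lemma not_depends_on_add_sum:
  assumes "\<And>w. w \<in> A \<Longrightarrow> \<not> depends_on f (g w)"
  shows "f (a + (\<Sum>w\<in>A. g w (b w))) = f a"
  using assms
proof (induction A arbitrary: a rule: infinite_finite_induct)
  case (insert w A)
  \<comment> \<open>The new summand is absorbed into the base point, over which the induction
    hypothesis is general; the scalar 1 matches the form of independence.\<close>
  have "f (a + (\<Sum>w\<in>insert w A. g w (b w))) = f ((a + 1 *\<^sub>R g w (b w)) + (\<Sum>w\<in>A. g w (b w)))"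
    using insert.hyps by (simp add: add.assoc)
  also have "\<dots> = f (a + 1 *\<^sub>R g w (b w))"
    using insert by blast
  also have "\<dots> = f a"
    using insert.prems[of w] not_depends_on_iff by blast
  finally show ?case .
qed simp_all

lemma solution_map_add:
  assumes s: "solution_map f s" and t: "solution_map g t"
    and ind: "\<And>a b. f (a + g b) = f a"
  shows "solution_map (\<lambda>m. f m + g m) (t \<circ> s)"
proof -
  have "m = c + (f m + g m) \<longleftrightarrow> m = t (s c)" for c m
  proof -
    \<comment> \<open>Independence at the base point \<open>m - g m\<close>: adding
      \<open>g m\<close> back gives \<open>m\<close>.\<close>
    have "f m = f (m - g m)"
      using ind[of "m - g m" m] by simp
    then have "m = c + (f m + g m) \<longleftrightarrow> m - g m = c + f (m - g m)"
      by (metis add.assoc diff_eq_eq)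
    also have "\<dots> \<longleftrightarrow> m - g m = s c"
      using s by (simp add: solution_map_def)
    also have "\<dots> \<longleftrightarrow> m = s c + g m"
      by (rule diff_eq_eq)
    also have "\<dots> \<longleftrightarrow> m = t (s c)"
      using t by (simp add: solution_map_def)
    finally show ?thesis .
  qed
  moreover have "continuous_on UNIV (t \<circ> s)"
    using s t continuous_on_subset
    by (intro continuous_on_compose) (auto simp: solution_map_def)
  ultimately show ?thesis
    by (simp add: solution_map_def)
qed

lemma solution_map_sum_independent:
  assumes "finite A"
    and s: "\<And>v. v \<in> A \<Longrightarrow> solution_map (f v) (s v)"
    and ind: "\<And>v w. v \<in> A \<Longrightarrow> w \<in> A \<Longrightarrow> v \<noteq> w \<Longrightarrow> \<not> depends_on (f v) (f w)"
  shows "solution_map (\<lambda>m. \<Sum>v\<in>A. f v m) (\<lambda>c. c + (\<Sum>v\<in>A. s v c - c))"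
proof -
  have fixpoint: "s v c = c + f v (s v c)" if "v \<in> A" for v c
    using s[OF that] by (simp add: solution_map_def)
  \<comment> \<open>The \<open>v\<close> summand survives because \<open>f v\<close> may depend on
    itself. The points \<open>b w\<close> are left free: below they are all \<open>m\<close> in one
    direction and \<open>s w c\<close> in the other.\<close>
  have drop: "f v (c + (\<Sum>w\<in>A. f w (b w))) = f v (c + f v (b v))" if "v \<in> A" for v c b
  proof -
    have "f v ((c + f v (b v)) + (\<Sum>w\<in>A - {v}. f w (b w))) = f v (c + f v (b v))"
      using ind that by (intro not_depends_on_add_sum) auto
    then show ?thesis
      using \<open>finite A\<close> that by (simp add: sum.remove add.assoc)
  qed
  have "m = c + (\<Sum>v\<in>A. f v m) \<longleftrightarrow> m = c + (\<Sum>v\<in>A. s v c - c)" for c m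
  proof
    assume m: "m = c + (\<Sum>v\<in>A. f v m)"
    have "f v m = s v c - c" if "v \<in> A" for v
    proof -
      have "f v m = f v (c + f v m)"
        using drop[OF that, of c "\<lambda>_. m"] m by simp
      then have "c + f v m = c + f v (c + f v m)"
        by simp
      then have "c + f v m = s v c"
        using s[OF that] unfolding solution_map_def by blast
      then show ?thesis
        by (simp add: algebra_simps)
    qed
    with m show "m = c + (\<Sum>v\<in>A. s v c - c)"
      by (metis (no_types, lifting) sum.cong)
  next
    assume m: "m = c + (\<Sum>v\<in>A. s v c - c)"
    have diff: "s v c - c = f v (s v c)" if "v \<in> A" for v
      using fixpoint[OF that, of c] by (simp add: diff_eq_eq add.commute)
    then have m': "m = c + (\<Sum>v\<in>A. f v (s v c))"
      using m by simp
    have "f v m = s v c - c" if "v \<in> A" for v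
    proof -
      \<comment> \<open>By \<open>fixpoint\<close> the argument on the right is \<open>s v c\<close>
        itself.\<close>
      have "f v m = f v (c + f v (s v c))"
        unfolding m' by (rule drop[OF that])
      then show ?thesis
        using fixpoint[OF that, of c] diff[OF that] by simp
    qed
    with m show "m = c + (\<Sum>v\<in>A. f v m)"
      by simp
  qed
  moreover have "continuous_on UNIV (\<lambda>c. c + (\<Sum>v\<in>A. s v c - c))"
    using s by (intro continuous_intros) (auto simp: solution_map_def)
  ultimately show ?thesis
    by (simp add: solution_map_def)
qed

text \<open>Induction on the height, splitting off the last layer. The case \<open>i = j\<close> of
  \<open>ind\<close> gives independence within a layer, the case \<open>i < j\<close> independence
  of earlier machines from later ones.\<close>

lemma solution_map_sum_layers:
  assumes fin: "\<And>l. l \<in> {1..k} \<Longrightarrow> finite (V l)"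
    and s: "\<And>l v. l \<in> {1..k} \<Longrightarrow> v \<in> V l \<Longrightarrow> solution_map (f v) (s v)"
    and ind: "\<And>i j v w. i \<in> {1..k} \<Longrightarrow> j \<in> {1..k} \<Longrightarrow> i \<le> j \<Longrightarrow> v \<in> V i \<Longrightarrow> w \<in> V j \<Longrightarrow> v \<noteq> w
      \<Longrightarrow> \<not> depends_on (f v) (f w)"
    and disj: "\<And>i j. i \<in> {1..k} \<Longrightarrow> j \<in> {1..k} \<Longrightarrow> i \<noteq> j \<Longrightarrow> V i \<inter> V j = {}"
  shows "solution_map (\<lambda>m. \<Sum>l=1..k. \<Sum>v\<in>V l. f v m)
    (compose_upto k (\<lambda>l m. m + (\<Sum>v\<in>V l. s v m - m)))"
  using assms
proof (induction k)
  case 0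
  then show ?case
    by (simp add: solution_map_def)
next
  case (Suc k)
  let ?F = "\<lambda>m. \<Sum>l=1..k. \<Sum>v\<in>V l. f v m" and ?G = "\<lambda>m. \<Sum>v\<in>V (Suc k). f v m"
  have "solution_map ?F (compose_upto k (\<lambda>l m. m + (\<Sum>v\<in>V l. s v m - m)))"
    by (rule Suc.IH; (rule Suc.prems; auto)?)
  moreover have "solution_map ?G (\<lambda>m. m + (\<Sum>v\<in>V (Suc k). s v m - m))"
    using Suc.prems(3)[of "Suc k" "Suc k"]
    by (intro solution_map_sum_independent Suc.prems(1,2)[of "Suc k"]) auto
  \<comment> \<open>Each summand of \<open>?F\<close> separately ignores the whole last layer;
    disjointness of layers provides the \<open>v \<noteq> w\<close> that \<open>ind\<close> asks
    for.\<close>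
  moreover have "?F (a + ?G b) = ?F a" for a b
  proof (intro sum.cong refl not_depends_on_add_sum[where g = f])
    fix l v w assume *: "l \<in> {1..k}" "v \<in> V l" "w \<in> V (Suc k)"
    then have "v \<noteq> w"
      using Suc.prems(4)[of l "Suc k"] by auto
    with * show "\<not> depends_on (f v) (f w)"
      by (intro Suc.prems(3)[of l "Suc k"]) auto
  qed
  ultimately have "solution_map (\<lambda>m. ?F m + ?G m)
      ((\<lambda>m. m + (\<Sum>v\<in>V (Suc k). s v m - m)) \<circ>
       compose_upto k (\<lambda>l m. m + (\<Sum>v\<in>V l. s v m - m)))"
    by (rule solution_map_add)
  then show ?case
    by (simp add: comp_def)
qed

theorem corollary1:
  fixes f :: "nat \<Rightarrow> 'm::real_topological_vector_space \<Rightarrow> 'm"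
    and n k :: nat
    and V :: "nat \<Rightarrow> nat set"
  assumes "\<And>i. i \<in> {1..n} \<Longrightarrow> machine TYPE('m) (f i)"
    and "acyclic (dependency_edges n f)"
    and "layering {1..n} (dependency_edges n f) k V"
  shows "machine TYPE('x) (\<lambda>m. \<Sum>i=1..n. f i m) \<and>
    S (\<lambda>m. \<Sum>i=1..n. f i m) =
      compose_upto k (\<lambda>l m. m + (\<Sum>v\<in>V l. (S (f v) m - m)))"
proof -
  have part: "partition_on {1..n} (V ` {1..k})" and inj: "inj_on V {1..k}"
    and edge: "\<And>i j v w. i \<in> {1..k} \<Longrightarrow> j \<in> {1..k} \<Longrightarrow> v \<in> V i \<Longrightarrow> w \<in> V j
      \<Longrightarrow> (v, w) \<in> dependency_edges n f \<Longrightarrow> i < j"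
    using assms(3) unfolding layering_def by blast+
  have union: "(\<Union>l\<in>{1..k}. V l) = {1..n}"
    using part by (simp add: partition_on_def)
  have disj: "V i \<inter> V j = {}" if "i \<in> {1..k}" "j \<in> {1..k}" "i \<noteq> j" for i j
  proof -
    \<comment> \<open>\<open>partition_on\<close> separates only distinct blocks, so injectivity is
      what turns distinct indices into disjoint layers.\<close>
    have "V i \<noteq> V j"
      using inj that by (meson inj_onD)
    with part that show ?thesis
      by (auto simp: partition_on_def disjoint_def)
  qed
  have fin: "finite (V l)" if "l \<in> {1..k}" for l
    using union that by (metis UN_upper finite_atLeastAtMost finite_subset)
  have "(\<Sum>i=1..n. f i m) = (\<Sum>l=1..k. \<Sum>v\<in>V l. f v m)" for m
    unfolding union[symmetric] by (rule sum.UNION_disjoint) (use fin disj in auto)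
  moreover have "solution_map (\<lambda>m. \<Sum>l=1..k. \<Sum>v\<in>V l. f v m)
    (compose_upto k (\<lambda>l m. m + (\<Sum>v\<in>V l. S (f v) m - m)))"
  proof (rule solution_map_sum_layers[OF fin _ _ disj])
    fix l v assume "l \<in> {1..k}" "v \<in> V l"
    then show "solution_map (f v) (S (f v))"
      using union assms(1) by (blast intro: machine_solution_map_S)
  next
    fix i j v w
    assume *: "i \<in> {1..k}" "j \<in> {1..k}" "i \<le> j" "v \<in> V i" "w \<in> V j" "v \<noteq> w"
    then have "v \<in> {1..n}" "w \<in> {1..n}"
      using union by blast+
    \<comment> \<open>An edge from \<open>w\<close> to \<open>v\<close> would force
      \<open>j < i\<close>. Since \<open>v\<close> and \<open>w\<close> are distinct vertices, the
      missing edge means independence.\<close>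
    moreover have "(w, v) \<notin> dependency_edges n f"
      using edge[of j i w v] * by auto
    ultimately show "\<not> depends_on (f v) (f w)"
      using * by (auto simp: dependency_edges_def)
  qed
  ultimately have sol: "solution_map (\<lambda>m. \<Sum>i=1..n. f i m)
    (compose_upto k (\<lambda>l m. m + (\<Sum>v\<in>V l. S (f v) m - m)))"
    by simp
  have "continuous_on UNIV (\<lambda>m. \<Sum>i=1..n. f i m)"
    using assms(1) by (intro continuous_on_sum) (auto simp: machine_def)
  \<comment> \<open>As \<open>solution_map\<close> involves no test type, the sum is a machine over
    any \<open>'x\<close>, although the summands were tested over \<open>'m\<close> only.\<close>
  with sol show ?thesis
    by (blast intro: solution_map_imp_machine S_eq_solution_map)
qed

end
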